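(* Let $Q\in\mathbb{S}^n$, $c\in\mathbb{R}^n$, $A\in\mathbb{R}^{m\times n}$ of full row rank, $b\in\mathbb{R}^m$, $B\in\mathbb{R}^{l\times n}$, $d\in\mathbb{R}^l$, and let $k$ be an integer with $0<k<n$. Assume that the mixed-binary problem (MIQP) of the context is feasible and has optimal value $v^{\mathrm{P}}>-\infty$, and let $v^{\mathrm{UB}}\in\mathbb{R}$ be any upper bound on $v^{\mathrm{P}}$. Let $(\alpha,\Gamma,\Lambda,W,S)$ be feasible for the dual problem (D) of the context, with objective value $v^{\mathrm{LB}}=\alpha$. For $i\in\{1,\dots,n\}$ let $w_i:=(W_{12})_i^2/(W_{22})_{ii}$ if $(W_{22})_{ii}>0$ and $w_i:=0$ otherwise, and let $w_{[i]}$ denote the $i$-th largest value among $w_1,\dots,w_n$ (counted with multiplicity). Let $(S_0,N,C)$ be an SCG-tuple with respect to $w$. If $$\sum_{i=1}^k w_{[i]}-\sum_{i\in S_0}w_i-\sum_{i\in C}w_i>v^{\mathrm{UB}}-v^{\mathrm{LB}},$$ then every optimal solution $(x,z)$ of (MIQP) satisfies $$\sum_{i\in S_0}z_i+\sum_{i\in N}(1-z_i)\le|S_0|+|N|-1.$$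
   Context: SCG-tuple: given two disjoint index sets $S_0,N\subseteq\{1,\dots,n\}$ with $|S_0|\le k$, let $R:=\{1,\dots,n\}\setminus(S_0\cup N)$ and $c_0:=\min\{k-|S_0|,|R|\}$. The triple $(S_0,N,C)$ is an SCG-tuple with respect to $w$ if $C=\{i\in R:\ w_i\ge(w_R)_{[c_0]}\}$, where $(w_R)_{[c_0]}$ is the $c_0$-th largest value (with multiplicity) among $\{w_i\}_{i\in R}$; if $c_0=0$, then $C=\emptyset$. $\mathbb{S}^n$ is the space of real symmetric $n\times n$ matrices, $\mathbb{S}^n_+$ its positive semidefinite cone, $\langle U,V\rangle=\mathrm{Tr}(UV^\top)$, $e$ the all-ones vector, $\circ$ the entrywise product, $E_{11}\in\mathbb{S}^{n+1}$ the matrix with $1$ in the $(1,1)$ entry and $0$ elsewhere. Matrices in $\mathbb{S}^{n+1}$ are partitioned as $W=\begin{bmatrix}W_{11}&W_{12} \\ W_{21}&W_{22}\end{bmatrix}$ with $W_{11}\in\mathbb{R}$, $W_{12}=W_{21}^\top\in\mathbb{R}^{1\times n}$, $W_{22}\in\mathbb{S}^n$. For a square matrix $M$, $\operatorname{Diag}(M)$ is the diagonal matrix with the same diagonal as $M$. (MIQP): $\min_{x,z}\{x^\top Qx+2c^\top x:\ Ax=b,\ Bx\ge d,\ x\circ(e-z)=0,\ e^\top z\le k,\ z\in\{0,1\}^n\}$. Let $\overline{Q}=\begin{bmatrix}0&c^\top \\ c&Q\end{bmatrix}$ and, for $Y\in\mathbb{S}^{n+1}$, $$\mathcal{A}(Y)=\begin{bmatrix}-b&A\end{bmatrix}Y\begin{bmatrix}-b^\top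 \\ A^\top\end{bmatrix},\quad \mathcal{B}(Y)=\begin{bmatrix}1&0 \\ -d&B\end{bmatrix}Y\begin{bmatrix}1&0 \\ -d&B\end{bmatrix}^\top,\quad \mathcal{D}(Y)=\begin{bmatrix}kY_{11}&Y_{12} \\ Y_{21}&\operatorname{Diag}(Y_{22})\end{bmatrix}.$$ $\mathcal{A}^*,\mathcal{B}^*,\mathcal{D}^*$ are the adjoints, with values in $\mathbb{S}^{n+1}$, of these linear maps with respect to $\langle\cdot,\cdot\rangle$ (e.g. $\langle\mathcal{B}(Y),\Lambda\rangle=\langle Y,\mathcal{B}^*(\Lambda)\rangle$ for all $Y\in\mathbb{S}^{n+1}$). (D): maximize $\alpha$ subject to $$\overline{Q}-\mathcal{A}^*(\Gamma)-\mathcal{B}^*(\Lambda)-\mathcal{D}^*(W)-S-\alpha E_{11}=0,$$ $\alpha\in\mathbb{R}$, $\Gamma\in\mathbb{S}^m$, $\Lambda\in\mathbb{R}^{(l+1)\times(l+1)}$ entrywise nonnegative, $W\in\mathbb{S}^{n+1}_+$, $S\in\mathbb{S}^{n+1}_+$. *)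

theory Defs
  imports
    "Jordan_Normal_Form.DL_Rank"
    "HOL-Library.Extended_Real"
begin

text \<open>
  Matrices and vectors are those of \<^theory>\<open>Jordan_Normal_Form.Matrix\<close>, so all dimensions are
  natural numbers and \<open>m = 0\<close> or \<open>l = 0\<close> (no equality or no inequality constraints) is allowed.
  Indices are shifted by one: \<open>{1,\<dots>,n}\<close> becomes \<open>{..<n}\<close>. In an \<open>(n+1) \<times> (n+1)\<close> matrix
  the row/column \<open>0\<close> is the distinguished one, and \<open>Suc i\<close> corresponds to the index \<open>i\<close>.
\<close>

definition sym_mats :: "nat \<Rightarrow> real mat set" where
  "sym_mats n = {M \<in> carrier_mat n n. M\<^sup>T = M}"

definition psd_mats :: "nat \<Rightarrow> real mat set" where
  "psd_mats n = {M \<in> sym_mats n. \<forall>v \<in> carrier_vec n. 0 \<le> v \<bullet> (M *\<^sub>v v)}"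

definition mat_inner :: "real mat \<Rightarrow> real mat \<Rightarrow> real" where
  "mat_inner U V = (\<Sum>i<dim_row U. (U * V\<^sup>T) $$ (i, i))"

text \<open>
  \<open>sym_adjoint N F\<close> is the adjoint, with values in the symmetric \<open>N \<times> N\<close> matrices, of a linear
  map \<open>F\<close> defined on the symmetric \<open>N \<times> N\<close> matrices. The lemmas at the end of this theory
  show that the description is proper for the three maps it is applied to.
\<close>

definition sym_adjoint :: "nat \<Rightarrow> (real mat \<Rightarrow> real mat) \<Rightarrow> real mat \<Rightarrow> real mat" where
  "sym_adjoint N F M =
     (THE Z. Z \<in> sym_mats N \<and> (\<forall>Y \<in> sym_mats N. mat_inner (F Y) M = mat_inner Y Z))"

definition miqp_obj :: "real mat \<Rightarrow> real vec \<Rightarrow> real vec \<Rightarrow> real" where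
  "miqp_obj Q c x = x \<bullet> (Q *\<^sub>v x) + 2 * (c \<bullet> x)"

text \<open>The order on vectors is the componentwise one.\<close>

definition miqp_feasible ::
  "nat \<Rightarrow> nat \<Rightarrow> real mat \<Rightarrow> real vec \<Rightarrow> real mat \<Rightarrow> real vec \<Rightarrow> (real vec \<times> real vec) set" where
  "miqp_feasible n k A b B d =
     {(x, z). x \<in> carrier_vec n \<and> z \<in> carrier_vec n \<and>
        A *\<^sub>v x = b \<and> d \<le> B *\<^sub>v x \<and>
        (\<forall>i<n. x $ i * (1 - z $ i) = 0) \<and>
        (\<Sum>i<n. z $ i) \<le> real k \<and>
        (\<forall>i<n. z $ i \<in> {0, 1})}"

definition miqp_value ::
  "nat \<Rightarrow> nat \<Rightarrow> real mat \<Rightarrow> real vec \<Rightarrow> real mat \<Rightarrow> real vec \<Rightarrow> real mat \<Rightarrow> real vec \<Rightarrow> ereal" where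
  "miqp_value n k Q c A b B d =
     (INF (x, z) \<in> miqp_feasible n k A b B d. ereal (miqp_obj Q c x))"

definition miqp_optimal ::
  "nat \<Rightarrow> nat \<Rightarrow> real mat \<Rightarrow> real vec \<Rightarrow> real mat \<Rightarrow> real vec \<Rightarrow> real mat \<Rightarrow> real vec
     \<Rightarrow> (real vec \<times> real vec) set" where
  "miqp_optimal n k Q c A b B d =
     {(x, z) \<in> miqp_feasible n k A b B d.
        \<forall>(x', z') \<in> miqp_feasible n k A b B d. miqp_obj Q c x \<le> miqp_obj Q c x'}"

definition Q_bar :: "nat \<Rightarrow> real mat \<Rightarrow> real vec \<Rightarrow> real mat" where
  "Q_bar n Q c = four_block_mat (0\<^sub>m 1 1) (mat_of_rows n [c]) (mat_of_cols n [c]) Q"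

definition A_block :: "nat \<Rightarrow> real mat \<Rightarrow> real vec \<Rightarrow> real mat" where
  "A_block m A b = mat_of_cols m (- b # cols A)"

definition A_op :: "nat \<Rightarrow> real mat \<Rightarrow> real vec \<Rightarrow> real mat \<Rightarrow> real mat" where
  "A_op m A b Y = A_block m A b * Y * (A_block m A b)\<^sup>T"

definition B_block :: "nat \<Rightarrow> nat \<Rightarrow> real mat \<Rightarrow> real vec \<Rightarrow> real mat" where
  "B_block n l B d = four_block_mat (1\<^sub>m 1) (0\<^sub>m 1 n) (mat_of_cols l [- d]) B"

definition B_op :: "nat \<Rightarrow> nat \<Rightarrow> real mat \<Rightarrow> real vec \<Rightarrow> real mat \<Rightarrow> real mat" where
  "B_op n l B d Y = B_block n l B d * Y * (B_block n l B d)\<^sup>T"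

definition D_op :: "nat \<Rightarrow> real mat \<Rightarrow> real mat" where
  "D_op k Y =
     (case split_block Y 1 1 of (Y11, Y12, Y21, Y22) \<Rightarrow>
        four_block_mat (real k \<cdot>\<^sub>m Y11) Y12
                       Y21 (mat_diag (dim_row Y22) (\<lambda>i. Y22 $$ (i, i))))"

definition E11 :: "nat \<Rightarrow> real mat" where
  "E11 n = mat (n + 1) (n + 1) (\<lambda>(i, j). if i = 0 \<and> j = 0 then 1 else 0)"

definition dual_feasible ::
  "nat \<Rightarrow> nat \<Rightarrow> nat \<Rightarrow> nat \<Rightarrow> real mat \<Rightarrow> real vec \<Rightarrow> real mat \<Rightarrow> real vec \<Rightarrow> real mat \<Rightarrow> real vec
     \<Rightarrow> (real \<times> real mat \<times> real mat \<times> real mat \<times> real mat) set" where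
  "dual_feasible n m l k Q c A b B d =
     {(\<alpha>, \<Gamma>, \<Lambda>, W, S).
        \<Gamma> \<in> sym_mats m \<and>
        \<Lambda> \<in> carrier_mat (l + 1) (l + 1) \<and> (\<forall>i<l + 1. \<forall>j<l + 1. 0 \<le> \<Lambda> $$ (i, j)) \<and>
        W \<in> psd_mats (n + 1) \<and> S \<in> psd_mats (n + 1) \<and>
        Q_bar n Q c
          - sym_adjoint (n + 1) (A_op m A b) \<Gamma>
          - sym_adjoint (n + 1) (B_op n l B d) \<Lambda>
          - sym_adjoint (n + 1) (D_op k) W
          - S - \<alpha> \<cdot>\<^sub>m E11 n = 0\<^sub>m (n + 1) (n + 1)}"

definition dual_weight :: "real mat \<Rightarrow> nat \<Rightarrow> real" where
  "dual_weight W i =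
     (if 0 < W $$ (Suc i, Suc i) then (W $$ (0, Suc i))\<^sup>2 / W $$ (Suc i, Suc i) else 0)"

text \<open>The \<open>j\<close>-th largest value, with multiplicity, of \<open>w\<close> on the finite set \<open>R\<close>; \<open>j\<close> counts from 1.\<close>

definition nth_largest :: "(nat \<Rightarrow> real) \<Rightarrow> nat set \<Rightarrow> nat \<Rightarrow> real" where
  "nth_largest w R j = rev (sorted_list_of_multiset (image_mset w (mset_set R))) ! (j - 1)"

definition scg_tuple ::
  "nat \<Rightarrow> nat \<Rightarrow> (nat \<Rightarrow> real) \<Rightarrow> nat set \<Rightarrow> nat set \<Rightarrow> nat set \<Rightarrow> bool" where
  "scg_tuple n k w S0 N C \<longleftrightarrow>
     S0 \<subseteq> {..<n} \<and> N \<subseteq> {..<n} \<and> S0 \<inter> N = {} \<and> card S0 \<le> k \<and>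
     (let R = {..<n} - (S0 \<union> N);
          c0 = min (k - card S0) (card R)
      in C = (if c0 = 0 then {} else {i \<in> R. nth_largest w R c0 \<le> w i}))"

lemma mat_inner_sum:
  assumes "U \<in> carrier_mat p q" "V \<in> carrier_mat p q"
  shows "mat_inner U V = (\<Sum>i<p. \<Sum>j<q. U $$ (i, j) * V $$ (i, j))"
  using assms unfolding mat_inner_def
  by (auto simp: scalar_prod_def atLeast0LessThan intro!: sum.cong)

lemma sym_mats_index:
  assumes "Y \<in> sym_mats n" "i < n" "j < n"
  shows "Y $$ (i, j) = Y $$ (j, i)"
proof -
  have Y: "Y \<in> carrier_mat n n" "Y\<^sup>T = Y" using assms(1) by (auto simp: sym_mats_def)
  have "Y $$ (i, j) = Y\<^sup>T $$ (i, j)" by (simp only: Y(2))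
  also have "\<dots> = Y $$ (j, i)" using Y(1) assms(2,3) by simp
  finally show ?thesis .
qed

lemma sym_adjointI:
  assumes Z: "Z \<in> sym_mats N"
    and eq: "\<And>Y. Y \<in> sym_mats N \<Longrightarrow> mat_inner (F Y) M = mat_inner Y Z"
  shows "sym_adjoint N F M = Z"
  unfolding sym_adjoint_def
proof (rule the_equality)
  show "Z \<in> sym_mats N \<and> (\<forall>Y \<in> sym_mats N. mat_inner (F Y) M = mat_inner Y Z)"
    using Z eq by blast
next
  fix Z' assume a: "Z' \<in> sym_mats N \<and> (\<forall>Y \<in> sym_mats N. mat_inner (F Y) M = mat_inner Y Z')"
  let ?D = "Z' - Z"
  have c: "Z \<in> carrier_mat N N" "Z' \<in> carrier_mat N N" using Z a by (auto simp: sym_mats_def)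
  have t: "Z\<^sup>T = Z" "Z'\<^sup>T = Z'" using Z a by (auto simp: sym_mats_def)
  have D: "?D \<in> sym_mats N"
    using c t by (auto simp: sym_mats_def transpose_minus[of Z' N N Z])
  have Dc: "?D \<in> carrier_mat N N" using c by auto
  have "mat_inner ?D Z = mat_inner ?D Z'" using a eq[OF D] D by simp
  then have "(\<Sum>i<N. \<Sum>j<N. ?D $$ (i, j) * ?D $$ (i, j)) = 0"
    unfolding mat_inner_sum[OF Dc c(1)] mat_inner_sum[OF Dc c(2)]
    using c by (simp add: right_diff_distrib sum_subtractf)
  then have "\<forall>i<N. \<forall>j<N. ?D $$ (i, j) = 0"
    by (auto simp: sum_nonneg_eq_0_iff sum_nonneg)
  then show "Z' = Z" using c by (intro eq_matI) auto
qed

lemma mat_inner_mult_left: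
  assumes "P \<in> carrier_mat p q" "X \<in> carrier_mat q r" "M \<in> carrier_mat p r"
  shows "mat_inner (P * X) M = mat_inner X (P\<^sup>T * M)"
proof -
  have "mat_inner (P * X) M = (\<Sum>i<p. \<Sum>j<r. \<Sum>s<q. P $$ (i, s) * X $$ (s, j) * M $$ (i, j))"
    using assms
    by (subst mat_inner_sum[of _ p r])
       (auto simp: scalar_prod_def atLeast0LessThan sum_distrib_right intro!: sum.cong)
  also have "\<dots> = (\<Sum>j<r. \<Sum>i<p. \<Sum>s<q. P $$ (i, s) * X $$ (s, j) * M $$ (i, j))"
    by (rule sum.swap)
  also have "\<dots> = (\<Sum>j<r. \<Sum>s<q. \<Sum>i<p. P $$ (i, s) * X $$ (s, j) * M $$ (i, j))"
    by (intro sum.cong sum.swap refl)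
  also have "\<dots> = (\<Sum>s<q. \<Sum>j<r. \<Sum>i<p. P $$ (i, s) * X $$ (s, j) * M $$ (i, j))"
    by (rule sum.swap)
  also have "\<dots> = mat_inner X (P\<^sup>T * M)"
    using assms
    by (subst mat_inner_sum[of _ q r])
       (auto simp: scalar_prod_def atLeast0LessThan sum_distrib_left ac_simps intro!: sum.cong)
  finally show ?thesis .
qed

lemma mat_inner_transpose:
  assumes "U \<in> carrier_mat p q" "V \<in> carrier_mat p q"
  shows "mat_inner U\<^sup>T V\<^sup>T = mat_inner U V"
proof -
  have "mat_inner U\<^sup>T V\<^sup>T = (\<Sum>j<q. \<Sum>i<p. U $$ (i, j) * V $$ (i, j))"
    using assms by (subst mat_inner_sum[of _ q p]) auto
  also have "\<dots> = mat_inner U V"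
    by (subst sum.swap) (simp add: mat_inner_sum[OF assms])
  finally show ?thesis .
qed

lemma sym_adjoint_congruence:
  assumes P: "P \<in> carrier_mat p N" and M: "M \<in> carrier_mat p p"
  shows "sym_adjoint N (\<lambda>Y. P * Y * P\<^sup>T) M = (1/2) \<cdot>\<^sub>m (P\<^sup>T * M * P + P\<^sup>T * M\<^sup>T * P)"
proof -
  define G where "G = P\<^sup>T * M * P"
  have G: "G \<in> carrier_mat N N" using P M by (auto simp: G_def)
  have GT: "G\<^sup>T = P\<^sup>T * M\<^sup>T * P"
    unfolding G_def using P M
    by (simp add: transpose_mult[of _ N p _ N] transpose_mult[of _ p p _ N]
        assoc_mult_mat[of _ N p _ p _ N])
  let ?Z = "(1/2) \<cdot>\<^sub>m (G + G\<^sup>T)"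
  have Z: "?Z \<in> sym_mats N"
    using G unfolding sym_mats_def by (auto intro!: eq_matI)
  have "sym_adjoint N (\<lambda>Y. P * Y * P\<^sup>T) M = ?Z"
  proof (rule sym_adjointI[OF Z])
    fix Y assume Y: "Y \<in> sym_mats N"
    then have Yc: "Y \<in> carrier_mat N N" and Yt: "Y\<^sup>T = Y" by (auto simp: sym_mats_def)
    have "mat_inner (P * Y * P\<^sup>T) M = mat_inner (P * (Y * P\<^sup>T)) M"
      using P Yc by (simp add: assoc_mult_mat[of _ p N _ N _ p])
    also have "\<dots> = mat_inner (Y * P\<^sup>T) (P\<^sup>T * M)"
      using P Yc M by (intro mat_inner_mult_left) auto
    also have "\<dots> = mat_inner (Y * P\<^sup>T)\<^sup>T (P\<^sup>T * M)\<^sup>T"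
      using P Yc M by (intro mat_inner_transpose[of _ N p, symmetric]) auto
    also have "\<dots> = mat_inner (P * Y) (P\<^sup>T * M)\<^sup>T"
      using P Yc Yt by (simp add: transpose_mult[of _ N N _ p])
    also have "\<dots> = mat_inner Y (P\<^sup>T * (P\<^sup>T * M)\<^sup>T)"
      using P Yc M by (intro mat_inner_mult_left) auto
    also have "P\<^sup>T * (P\<^sup>T * M)\<^sup>T = G\<^sup>T"
      unfolding G_def using P M by (intro transpose_mult[of _ N p _ N, symmetric]) auto
    finally have 1: "mat_inner (P * Y * P\<^sup>T) M = mat_inner Y G\<^sup>T" .
    have 2: "mat_inner Y G\<^sup>T = mat_inner Y G"
      using mat_inner_transpose[OF Yc G] Yt by simp
    have Zc: "?Z \<in> carrier_mat N N" and GTc: "G\<^sup>T \<in> carrier_mat N N" using G by auto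
    have "mat_inner Y ?Z = (\<Sum>i<N. \<Sum>j<N. (1/2) * (Y $$ (i, j) * G $$ (i, j) + Y $$ (i, j) * G\<^sup>T $$ (i, j)))"
      unfolding mat_inner_sum[OF Yc Zc]
      using G by (intro sum.cong refl) (simp add: distrib_left)
    also have "\<dots> = (1/2) * (mat_inner Y G + mat_inner Y G\<^sup>T)"
      unfolding mat_inner_sum[OF Yc G] mat_inner_sum[OF Yc GTc]
      by (simp only: sum_distrib_left[symmetric] sum.distrib)
    finally have "mat_inner Y ?Z = (1/2) * (mat_inner Y G + mat_inner Y G\<^sup>T)" .
    then show "mat_inner (P * Y * P\<^sup>T) M = mat_inner Y ?Z"
      using 1 2 by simp
  qed
  then show ?thesis by (simp add: GT) (simp add: G_def)
qed

lemma A_block_carrier: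
  assumes "A \<in> carrier_mat m n"
  shows "A_block m A b \<in> carrier_mat m (n + 1)"
  using assms mat_of_cols_carrier(1)[of m "- b # cols A"] by (auto simp: A_block_def)

lemma B_block_carrier:
  assumes "B \<in> carrier_mat l n"
  shows "B_block n l B d \<in> carrier_mat (l + 1) (n + 1)"
  using assms four_block_carrier_mat[of "1\<^sub>m 1" 1 1 B l n] by (auto simp: B_block_def)

lemma sym_adjoint_A_op:
  assumes "A \<in> carrier_mat m n" "\<Gamma> \<in> sym_mats m"
  shows "sym_adjoint (n + 1) (A_op m A b) \<Gamma> = (A_block m A b)\<^sup>T * \<Gamma> * A_block m A b"
proof -
  have c: "(A_block m A b)\<^sup>T * \<Gamma> * A_block m A b \<in> carrier_mat (n + 1) (n + 1)"
    using A_block_carrier[OF assms(1), of b] assms(2) by (auto simp: sym_mats_def)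
  have "sym_adjoint (n + 1) (A_op m A b) \<Gamma> =
      (1/2) \<cdot>\<^sub>m ((A_block m A b)\<^sup>T * \<Gamma> * A_block m A b + (A_block m A b)\<^sup>T * \<Gamma> * A_block m A b)"
    using sym_adjoint_congruence[OF A_block_carrier[OF assms(1), of b], of \<Gamma>] assms(2)
    unfolding A_op_def[abs_def] by (simp add: sym_mats_def)
  then show ?thesis using c by (auto intro!: eq_matI)
qed

lemma sym_adjoint_B_op:
  assumes "B \<in> carrier_mat l n" "\<Lambda> \<in> carrier_mat (l + 1) (l + 1)"
  shows "sym_adjoint (n + 1) (B_op n l B d) \<Lambda> =
    (1/2) \<cdot>\<^sub>m ((B_block n l B d)\<^sup>T * \<Lambda> * B_block n l B d + (B_block n l B d)\<^sup>T * \<Lambda>\<^sup>T * B_block n l B d)"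
  using sym_adjoint_congruence[OF B_block_carrier[OF assms(1), of d] assms(2)]
  unfolding B_op_def[abs_def] .

lemma D_op_eq:
  assumes "Y \<in> carrier_mat (n + 1) (n + 1)"
  shows "D_op k Y = mat (n + 1) (n + 1) (\<lambda>(i, j).
    if i = 0 \<and> j = 0 then real k * Y $$ (0, 0)
    else if i = 0 \<or> j = 0 \<or> i = j then Y $$ (i, j) else 0)"
  using assms unfolding D_op_def split_block_def Let_def
  by (intro eq_matI) (auto simp: mat_diag_def)

lemma sym_adjoint_D_op:
  assumes W: "W \<in> sym_mats (n + 1)"
  shows "sym_adjoint (n + 1) (D_op k) W = D_op k W"
proof (rule sym_adjointI)
  have Wc: "W \<in> carrier_mat (n + 1) (n + 1)" using W by (auto simp: sym_mats_def)
  show "D_op k W \<in> sym_mats (n + 1)"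
    unfolding D_op_eq[OF Wc] using sym_mats_index[OF W]
    by (auto simp: sym_mats_def intro!: eq_matI)
  fix Y assume "Y \<in> sym_mats (n + 1)"
  then have Yc: "Y \<in> carrier_mat (n + 1) (n + 1)" by (auto simp: sym_mats_def)
  show "mat_inner (D_op k Y) W = mat_inner Y (D_op k W)"
    unfolding D_op_eq[OF Yc] D_op_eq[OF Wc] using Yc Wc
    by (simp add: mat_inner_sum[of _ "n + 1" "n + 1"] del: sum.lessThan_Suc)
       (intro sum.cong refl; simp)
qed

end

theory Submission
  imports Defs
begin

text \<open>
  Evaluate the dual equation as a quadratic form at the lifted vector \<open>y = (1, x)\<close> of a feasible
  \<open>x\<close>: the \<open>\<Gamma>\<close>-term vanishes, the \<open>\<Lambda>\<close>- and \<open>S\<close>-terms are nonnegative, and minimizing the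
  \<open>W\<close>-term coordinatewise over the support \<open>T\<close> of \<open>z\<close> costs at most \<open>w\<^sub>i\<close> for each \<open>i \<in> T\<close>. Hence the
  objective is at least \<open>\<alpha> + k W\<^sub>1\<^sub>1 - \<Sum>\<^sub>T w\<close>. The \<open>2 \<times> 2\<close> minors of \<open>W\<close> give \<open>w\<^sub>i \<le> W\<^sub>1\<^sub>1\<close>, so
  \<open>k W\<^sub>1\<^sub>1\<close> dominates the sum of the \<open>k\<close> largest weights. If \<open>z\<close> violated the cut, then \<open>T\<close> would
  contain \<open>S0\<close> and avoid \<open>N\<close>, and since \<open>C\<close> collects the largest weights available outside
  \<open>S0 \<union> N\<close>, \<open>\<Sum>\<^sub>T w\<close> would be at most the sum of \<open>w\<close> over \<open>S0\<close> and \<open>C\<close>. The gap assumption then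
  pushes the optimal value above \<open>vUB\<close>.
\<close>

section \<open>Order statistics and the weight sums of SCG-tuples\<close>

lemma nth_largest_enumeration:
  assumes "finite R"
  obtains xs where "distinct xs" "set xs = R" "length xs = card R"
    "\<And>j. 0 < j \<Longrightarrow> j \<le> card R \<Longrightarrow> nth_largest w R j = w (xs ! (j - 1))"
    "\<And>i j. i \<le> j \<Longrightarrow> j < card R \<Longrightarrow> w (xs ! j) \<le> w (xs ! i)"
proof -
  \<comment> \<open>Sorting the indices by their weight, rather than the multiset of values, records
    which index carries each rank; the reversal puts rank \<open>j\<close> at position
    \<open>j - 1\<close>.\<close>
  define ys where "ys = sort_key w (sorted_list_of_set R)"
  define xs where "xs = rev ys"
  have ys: "distinct ys" "set ys = R" "length ys = card R"
    using assms by (auto simp: ys_def)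
  have "mset ys = mset_set R"
    using ys by (metis mset_set_set)
  then have mset: "mset (map w ys) = image_mset w (mset_set R)"
    by simp
  have sorted: "sorted (map w ys)"
    by (simp add: ys_def)
  have "sorted_list_of_multiset (image_mset w (mset_set R)) = map w ys"
    using mset sorted by (metis sorted_list_of_multiset_mset sorted_sort_id)
  then have L: "rev (sorted_list_of_multiset (image_mset w (mset_set R))) = map w xs"
    by (simp add: xs_def rev_map)
  have len: "length xs = card R"
    by (simp add: xs_def ys)
  show thesis
  proof
    show "distinct xs" "set xs = R" "length xs = card R"
      using ys by (auto simp: xs_def)
    show "nth_largest w R j = w (xs ! (j - 1))" if "0 < j" "j \<le> card R" for j
      unfolding nth_largest_def L using that len by simp
    show "w (xs ! j) \<le> w (xs ! i)" if "i \<le> j" "j < card R" for i j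
    proof -
      have "map w ys ! (card R - Suc j) \<le> map w ys ! (card R - Suc i)"
        by (rule sorted_nth_mono[OF sorted]) (use that ys in auto)
      then show ?thesis
        using that ys by (simp add: xs_def rev_nth)
    qed
  qed
qed

lemma sum_nth_largest_le:
  assumes "finite R" "k \<le> card R" "\<And>i. i \<in> R \<Longrightarrow> w i \<le> M"
  shows "(\<Sum>i = 1..k. nth_largest w R i) \<le> real k * M"
proof -
  obtain xs where xs: "set xs = R" "length xs = card R"
    "\<And>j. 0 < j \<Longrightarrow> j \<le> card R \<Longrightarrow> nth_largest w R j = w (xs ! (j - 1))"
    using nth_largest_enumeration[OF assms(1)] by metis
  have "nth_largest w R i \<le> M" if "i \<in> {1..k}" for i
    using that assms xs by (auto intro!: assms(3))
  then have "(\<Sum>i = 1..k. nth_largest w R i) \<le> of_nat (card {1..k}) * M"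
    by (rule sum_bounded_above)
  then show ?thesis by simp
qed

text \<open>An exchange argument with the \<open>j\<close>-th largest value as threshold. Ties can
  only enlarge the superlevel set, so it has at least \<open>j\<close> elements. Trading the part of
  \<open>T\<close> outside it for its part outside \<open>T\<close> replaces weights below the
  threshold by at least as many weights that reach it.\<close>

lemma sum_le_sum_superlevel_nth_largest:
  fixes w :: "nat \<Rightarrow> real"
  assumes R: "finite R" and T: "T \<subseteq> R" "card T \<le> j" and j: "0 < j" "j \<le> card R"
    and nonneg: "\<And>i. i \<in> R \<Longrightarrow> 0 \<le> w i"
  shows "sum w T \<le> sum w {i \<in> R. nth_largest w R j \<le> w i}"
proof -
  define t where "t = nth_largest w R j"
  define C where "C = {i \<in> R. t \<le> w i}"
  obtain xs where xs: "distinct xs" "set xs = R" "length xs = card R"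
    "t = w (xs ! (j - 1))"
    "\<And>i j. i \<le> j \<Longrightarrow> j < card R \<Longrightarrow> w (xs ! j) \<le> w (xs ! i)"
    using nth_largest_enumeration[OF R] j unfolding t_def by metis
  \<comment> \<open>The two set differences may differ in size, so their cardinality inequality can
    be multiplied by \<open>t\<close> only if \<open>t\<close> is nonnegative.\<close>
  have t: "0 \<le> t"
    using xs j by (auto intro!: nonneg)
  have fin: "finite C" "finite T"
    using R T by (auto simp: C_def intro: finite_subset)
  have "set (take j xs) \<subseteq> C"
  proof
    fix a assume a: "a \<in> set (take j xs)"
    then obtain i where "i < j" "a = xs ! i"
      using xs j by (auto simp: in_set_conv_nth)
    moreover have "a \<in> R"
      using a xs by (auto dest: in_set_takeD)
    ultimately show "a \<in> C"
      using xs(4) xs(5)[of i "j - 1"] j by (simp add: C_def)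
  qed
  then have "card (set (take j xs)) \<le> card C"
    using fin by (intro card_mono)
  then have "j \<le> card C"
    using xs j by (simp add: distinct_card)
  then have "card (T - C) \<le> card (C - T)"
    using T(2) fin by (metis card_le_sym_Diff le_trans)
  then have cards: "real (card (T - C)) * t \<le> real (card (C - T)) * t"
    using t by (intro mult_right_mono) auto
  have "sum w (T - C) \<le> real (card (T - C)) * t"
    by (rule sum_bounded_above) (use T in \<open>auto simp: C_def\<close>)
  also note cards
  also have "real (card (C - T)) * t \<le> sum w (C - T)"
    by (rule sum_bounded_below) (auto simp: C_def)
  finally have "sum w (T - C) \<le> sum w (C - T)" .
  moreover have "sum w T = sum w (T \<inter> C) + sum w (T - C)"
    using fin by (metis sum.Int_Diff)
  moreover have "sum w C = sum w (T \<inter> C) + sum w (C - T)"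
    using fin by (metis sum.Int_Diff inf_commute)
  ultimately show ?thesis
    by (simp add: C_def t_def)
qed

text \<open>Once \<open>S0\<close> is removed, \<open>T\<close> has at most
  \<open>k - card S0\<close> elements, all of them in \<open>R\<close>. Hence at most
  \<open>c0\<close> remain, and the threshold comparison at rank \<open>c0\<close> applies.\<close>

lemma scg_tuple_sum_le:
  fixes w :: "nat \<Rightarrow> real"
  assumes scg: "scg_tuple n k w S0 N C"
    and T: "S0 \<subseteq> T" "T \<inter> N = {}" "T \<subseteq> {..<n}" "card T \<le> k"
    and nonneg: "\<And>i. i < n \<Longrightarrow> 0 \<le> w i"
  shows "sum w T \<le> sum w S0 + sum w C"
proof -
  define R where "R = {..<n} - (S0 \<union> N)"
  define c0 where "c0 = min (k - card S0) (card R)"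
  have C: "C = (if c0 = 0 then {} else {i \<in> R. nth_largest w R c0 \<le> w i})"
    using scg by (auto simp: scg_tuple_def Let_def R_def c0_def)
  have fin: "finite T" "finite R" "finite S0"
    using T by (auto simp: R_def intro: finite_subset)
  have sub: "T - S0 \<subseteq> R"
    using T by (auto simp: R_def)
  have "card (T - S0) = card T - card S0"
    using T fin by (intro card_Diff_subset) auto
  moreover have "card (T - S0) \<le> card R"
    using sub fin by (intro card_mono)
  ultimately have card: "card (T - S0) \<le> c0"
    using T(4) by (simp add: c0_def)
  have "sum w (T - S0) \<le> sum w C"
  proof (cases "c0 = 0")
    \<comment> \<open>Rank 0 does not exist; here \<open>S0\<close> already exhausts
      \<open>T\<close>, so the empty \<open>C\<close> is correct.\<close>
    case True
    then have "T - S0 = {}"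
      using card fin by (metis card_eq_0_iff finite_Diff le_zero_eq)
    then have "sum w (T - S0) = 0" by (simp only: sum.empty)
    then show ?thesis
      using True C by simp
  next
    case False
    have "sum w (T - S0) \<le> sum w {i \<in> R. nth_largest w R c0 \<le> w i}"
      by (rule sum_le_sum_superlevel_nth_largest[OF fin(2) sub card])
        (use False nonneg in \<open>auto simp: c0_def R_def\<close>)
    then show ?thesis
      using False C by simp
  qed
  moreover have "sum w T = sum w S0 + sum w (T - S0)"
    using T fin by (metis add.commute sum.subset_diff)
  ultimately show ?thesis by simp
qed

section \<open>Quadratic forms\<close>

definition quad_form :: "real mat \<Rightarrow> real vec \<Rightarrow> real" where
  "quad_form M v = v \<bullet> (M *\<^sub>v v)"

lemma quad_form_sum:
  assumes "M \<in> carrier_mat n n" "v \<in> carrier_vec n"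
  shows "quad_form M v = (\<Sum>i<n. \<Sum>j<n. v $ i * M $$ (i, j) * v $ j)"
  using assms
  by (auto simp: quad_form_def scalar_prod_def atLeast0LessThan sum_distrib_left mult.assoc
      intro!: sum.cong)

lemma quad_form_minus:
  assumes "M \<in> carrier_mat n n" "M' \<in> carrier_mat n n" "v \<in> carrier_vec n"
  shows "quad_form (M - M') v = quad_form M v - quad_form M' v"
  using assms by (simp add: quad_form_def minus_mult_distrib_mat_vec[of _ n n]
      scalar_prod_minus_distrib[of _ n])

lemma quad_form_add:
  assumes "M \<in> carrier_mat n n" "M' \<in> carrier_mat n n" "v \<in> carrier_vec n"
  shows "quad_form (M + M') v = quad_form M v + quad_form M' v"
  using assms by (simp add: quad_form_def add_mult_distrib_mat_vec[of _ n n]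
      scalar_prod_add_distrib[of _ n])

lemma quad_form_smult:
  assumes "M \<in> carrier_mat n n" "v \<in> carrier_vec n"
  shows "quad_form (a \<cdot>\<^sub>m M) v = a * quad_form M v"
  using assms by (simp add: quad_form_sum[of _ n] sum_distrib_left ac_simps)

text \<open>Moves \<open>P\<close> onto the vector, so that the adjoint terms of the dual can be
  evaluated at constraint residuals.\<close>

lemma quad_form_congruence:
  assumes "P \<in> carrier_mat p n" "M \<in> carrier_mat p p" "v \<in> carrier_vec n"
  shows "quad_form (P\<^sup>T * M * P) v = quad_form M (P *\<^sub>v v)"
proof -
  have "v \<bullet> (P\<^sup>T * M * P *\<^sub>v v) = v \<bullet> (P\<^sup>T *\<^sub>v (M *\<^sub>v (P *\<^sub>v v)))"
    using assms by (simp add: assoc_mult_mat_vec[of _ n p _ n] assoc_mult_mat_vec[of _ n p _ p])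
  also have "\<dots> = (P\<^sup>T *\<^sub>v (M *\<^sub>v (P *\<^sub>v v))) \<bullet> v"
    using assms by (intro comm_scalar_prod[of _ n]) auto
  also have "\<dots> = (M *\<^sub>v (P *\<^sub>v v)) \<bullet> (P *\<^sub>v v)"
    using assms by (intro transpose_vec_mult_scalar) auto
  also have "\<dots> = (P *\<^sub>v v) \<bullet> (M *\<^sub>v (P *\<^sub>v v))"
    using assms by (intro comm_scalar_prod[of _ p]) auto
  finally show ?thesis by (simp add: quad_form_def)
qed

lemma quad_form_nonneg:
  assumes "M \<in> carrier_mat n n" "v \<in> carrier_vec n"
    "\<And>i j. i < n \<Longrightarrow> j < n \<Longrightarrow> 0 \<le> M $$ (i, j)" "\<And>i. i < n \<Longrightarrow> 0 \<le> v $ i"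
  shows "0 \<le> quad_form M v"
  using assms by (auto simp: quad_form_sum[of _ n] intro!: sum_nonneg)

lemma psd_quad_form_nonneg:
  assumes "M \<in> psd_mats n" "v \<in> carrier_vec n"
  shows "0 \<le> quad_form M v"
  using assms by (auto simp: quad_form_def psd_mats_def)

lemma quad_form_vCons:
  assumes M: "M \<in> sym_mats (n + 1)" and x: "x \<in> carrier_vec n"
  shows "quad_form M (vCons a x) = a\<^sup>2 * M $$ (0, 0) + 2 * a * (\<Sum>i<n. M $$ (0, Suc i) * x $ i)
    + (\<Sum>i<n. \<Sum>j<n. x $ i * M $$ (Suc i, Suc j) * x $ j)"
proof -
  have Mc: "M \<in> carrier_mat (Suc n) (Suc n)" using M by (auto simp: sym_mats_def)
  have "M $$ (Suc i, 0) = M $$ (0, Suc i)" if "i < n" for i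
    using sym_mats_index[OF M] that by simp
  then show ?thesis
    using x by (simp add: quad_form_sum[OF Mc] sum.lessThan_Suc_shift sum.distrib
        sum_distrib_left power2_eq_square algebra_simps del: sum.lessThan_Suc)
qed

text \<open>Restricts the form to the plane of the coordinates 0 and \<open>Suc i\<close>, that is,
  to a 2-by-2 principal submatrix. Keeping \<open>s\<close> and \<open>t\<close> free, instead of
  passing to the determinant, lets each use choose its direction.\<close>

lemma psd_two_dim:
  assumes M: "M \<in> psd_mats (n + 1)" and i: "i < n"
  shows "0 \<le> s\<^sup>2 * M $$ (0, 0) + 2 * s * t * M $$ (0, Suc i) + t\<^sup>2 * M $$ (Suc i, Suc i)"
proof -
  define v where "v = t \<cdot>\<^sub>v unit_vec n i"
  have v: "v \<in> carrier_vec n" by (simp add: v_def)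
  have v_nth: "v $ j = (if j = i then t else 0)" if "j < n" for j
    using that i by (simp add: v_def unit_vec_def)
  have sums: "(\<Sum>j<n. f j * v $ j) = f i * t" for f
  proof -
    have "(\<Sum>j<n. f j * v $ j) = (\<Sum>j<n. if j = i then f j * t else 0)"
      by (intro sum.cong) (auto simp: v_nth)
    then show ?thesis using i by simp
  qed
  have "0 \<le> quad_form M (vCons s v)"
    using psd_quad_form_nonneg[OF M] v by simp
  also have "\<dots> = s\<^sup>2 * M $$ (0, 0) + 2 * s * (M $$ (0, Suc i) * t)
      + (\<Sum>j<n. v $ j * M $$ (Suc j, Suc i) * t)"
    using M by (subst quad_form_vCons[OF _ v]) (auto simp: psd_mats_def sums)
  also have "(\<Sum>j<n. v $ j * M $$ (Suc j, Suc i) * t) = M $$ (Suc i, Suc i) * t * t"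
    using sums[of "\<lambda>j. M $$ (Suc j, Suc i) * t"] by (simp add: ac_simps)
  finally show ?thesis by (simp add: power2_eq_square ac_simps)
qed

section \<open>Bounds on and by the dual weights\<close>

lemma dual_weight_nonneg: "0 \<le> dual_weight W i"
  by (simp add: dual_weight_def)

lemma dual_weight_le:
  assumes W: "W \<in> psd_mats (n + 1)" and i: "i < n"
  shows "dual_weight W i \<le> W $$ (0, 0)"
proof (cases "0 < W $$ (Suc i, Suc i)")
  case True
  then show ?thesis
    \<comment> \<open>This \<open>t\<close> is the minimizer for \<open>s = 1\<close>; the minimum
      is the corner entry minus the weight.\<close>
    using psd_two_dim[OF W i, of 1 "- W $$ (0, Suc i) / W $$ (Suc i, Suc i)"]
    by (simp add: dual_weight_def field_simps power2_eq_square)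
next
  case False
  then show ?thesis
    using psd_two_dim[OF W i, of 1 0] by (simp add: dual_weight_def)
qed

text \<open>Completing the square gives minus the weight as the minimum over \<open>x\<close>. If
  the diagonal entry is zero, semidefiniteness kills the linear coefficient too, which justifies the
  default weight 0.\<close>

lemma dual_weight_ge:
  assumes W: "W \<in> psd_mats (n + 1)" and i: "i < n"
  shows "- dual_weight W i \<le> 2 * (W $$ (0, Suc i) * x) + W $$ (Suc i, Suc i) * x\<^sup>2"
proof (cases "0 < W $$ (Suc i, Suc i)")
  case True
  define p q where "p = W $$ (0, Suc i)" and "q = W $$ (Suc i, Suc i)"
  have "0 \<le> (p + q * x)\<^sup>2 / q"
    using True by (simp add: q_def)
  also have "\<dots> = p\<^sup>2 / q + (2 * (p * x) + q * x\<^sup>2)"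
    using True by (simp add: q_def[symmetric] field_simps power2_eq_square)
  finally show ?thesis
    using True by (simp add: dual_weight_def p_def q_def)
next
  case False
  have q: "W $$ (Suc i, Suc i) = 0"
    using False psd_two_dim[OF W i, of 0 1] by simp
  define a p where "a = W $$ (0, 0)" and "p = W $$ (0, Suc i)"
  have psd: "0 \<le> a + 2 * t * p" for t
    using psd_two_dim[OF W i, of 1 t] by (simp add: q a_def p_def)
  have "p = 0"
  proof (rule ccontr)
    assume "p \<noteq> 0"
    \<comment> \<open>This value of \<open>t\<close> makes \<open>a + 2 * t * p\<close> equal to
      -1.\<close>
    then have "2 * (- (a + 1) / (2 * p)) * p = - (a + 1)" by (simp add: field_simps)
    then show False using psd[of "- (a + 1) / (2 * p)"] by linarith
  qed
  then show ?thesis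
    by (simp add: q dual_weight_def p_def)
qed

section \<open>The dual equation at lifted vectors\<close>

lemma quad_form_Q_bar:
  assumes Q: "Q \<in> sym_mats n" and c: "c \<in> carrier_vec n" and x: "x \<in> carrier_vec n"
  shows "quad_form (Q_bar n Q c) (vCons 1 x) = miqp_obj Q c x"
proof -
  have Qc: "Q \<in> carrier_mat n n" using Q by (auto simp: sym_mats_def)
  have sym: "Q_bar n Q c \<in> sym_mats (n + 1)"
    using Qc c sym_mats_index[OF Q]
    by (auto simp: sym_mats_def Q_bar_def mat_of_rows_index mat_of_cols_index intro!: eq_matI)
  have "quad_form (Q_bar n Q c) (vCons 1 x)
      = 2 * (\<Sum>i<n. c $ i * x $ i) + (\<Sum>i<n. \<Sum>j<n. x $ i * Q $$ (i, j) * x $ j)"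
    unfolding quad_form_vCons[OF sym x]
    using Qc c by (simp add: Q_bar_def mat_of_rows_index)
  also have "\<dots> = 2 * (c \<bullet> x) + quad_form Q x"
    using x by (simp add: quad_form_sum[OF Qc x] scalar_prod_def atLeast0LessThan)
  finally show ?thesis
    by (simp add: miqp_obj_def quad_form_def)
qed

lemma quad_form_E11:
  assumes x: "x \<in> carrier_vec n"
  shows "quad_form (E11 n) (vCons 1 x) = 1"
proof -
  have "E11 n \<in> sym_mats (n + 1)"
    by (auto simp: sym_mats_def E11_def intro!: eq_matI)
  from quad_form_vCons[OF this x] show ?thesis by (simp add: E11_def)
qed

text \<open>Keeping only the diagonal of the lower right block removes the products of distinct
  coordinates, so the form separates into one-variable quadratics.\<close>

lemma quad_form_D_op:
  assumes W: "W \<in> sym_mats (n + 1)" and x: "x \<in> carrier_vec n"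
  shows "quad_form (D_op k W) (vCons 1 x) = real k * W $$ (0, 0)
    + (\<Sum>i<n. 2 * (W $$ (0, Suc i) * x $ i) + W $$ (Suc i, Suc i) * (x $ i)\<^sup>2)"
proof -
  have Wc: "W \<in> carrier_mat (n + 1) (n + 1)" using W by (auto simp: sym_mats_def)
  have sym: "D_op k W \<in> sym_mats (n + 1)"
    unfolding D_op_eq[OF Wc] using sym_mats_index[OF W]
    by (auto simp: sym_mats_def intro!: eq_matI)
  have diag: "(\<Sum>j<n. x $ i * D_op k W $$ (Suc i, Suc j) * x $ j)
      = W $$ (Suc i, Suc i) * (x $ i)\<^sup>2" if "i < n" for i
  proof -
    have "(\<Sum>j<n. x $ i * D_op k W $$ (Suc i, Suc j) * x $ j)
        = (\<Sum>j<n. if j = i then W $$ (Suc i, Suc i) * (x $ i)\<^sup>2 else 0)"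
      using that unfolding D_op_eq[OF Wc]
      by (intro sum.cong) (auto simp: power2_eq_square)
    then show ?thesis using that by simp
  qed
  show ?thesis
    unfolding quad_form_vCons[OF sym x]
    by (simp add: diag sum.distrib sum_distrib_left) (simp add: D_op_eq[OF Wc])
qed

lemma A_block_mult_vCons:
  assumes A: "A \<in> carrier_mat m n" and b: "b \<in> carrier_vec m" and x: "x \<in> carrier_vec n"
  shows "A_block m A b *\<^sub>v vCons 1 x = A *\<^sub>v x - b"
proof (rule eq_vecI)
  fix i assume "i < dim_vec (A *\<^sub>v x - b)"
  then have i: "i < m" using b by simp
  have "row (A_block m A b) i = vCons (- b $ i) (row A i)"
    using i A b by (intro eq_vecI)
      (auto simp: A_block_def mat_of_cols_index vec_index_vCons nth_Cons' less_Suc_eq_0_disj)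
  then show "(A_block m A b *\<^sub>v vCons 1 x) $ i = (A *\<^sub>v x - b) $ i"
    using i A b A_block_carrier[OF A, of b] by simp
qed (use A b A_block_carrier[OF A, of b] in auto)

text \<open>The extra top row reproduces the leading 1, so at a feasible \<open>x\<close> the image
  is the nonnegative vector of 1 and all slacks.\<close>

lemma B_block_mult_vCons:
  assumes B: "B \<in> carrier_mat l n" and d: "d \<in> carrier_vec l" and x: "x \<in> carrier_vec n"
  shows "B_block n l B d *\<^sub>v vCons 1 x = vCons 1 (B *\<^sub>v x - d)"
proof (rule eq_vecI)
  fix i assume "i < dim_vec (vCons 1 (B *\<^sub>v x - d))"
  then have i: "i < Suc l" using d by simp
  have "row (B_block n l B d) i
      = (if i = 0 then vCons 1 (0\<^sub>v n) else vCons (- d $ (i - 1)) (row B (i - 1)))"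
    using i B d by (intro eq_vecI)
      (auto simp: B_block_def mat_of_cols_index vec_index_vCons less_Suc_eq_0_disj)
  then show "(B_block n l B d *\<^sub>v vCons 1 x) $ i = vCons 1 (B *\<^sub>v x - d) $ i"
    using i B d x B_block_carrier[OF B, of d] by (cases i) simp_all
qed (use B d B_block_carrier[OF B, of d] in auto)

text \<open>Weak duality from the linear constraints alone. The \<open>W\<close>-term is kept exact,
  because bounding it takes the support of \<open>z\<close>.\<close>

lemma dual_feasible_objective_ge:
  assumes Q: "Q \<in> sym_mats n" and c: "c \<in> carrier_vec n"
    and A: "A \<in> carrier_mat m n" and b: "b \<in> carrier_vec m"
    and B: "B \<in> carrier_mat l n" and d: "d \<in> carrier_vec l"
    and dual: "(\<alpha>, \<Gamma>, \<Lambda>, W, S) \<in> dual_feasible n m l k Q c A b B d"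
    and x: "x \<in> carrier_vec n" "A *\<^sub>v x = b" "d \<le> B *\<^sub>v x"
  shows "\<alpha> + quad_form (D_op k W) (vCons 1 x) \<le> miqp_obj Q c x"
proof -
  define y where "y = vCons 1 x"
  define PA PB where "PA = A_block m A b" and "PB = B_block n l B d"
  define ZA where "ZA = PA\<^sup>T * \<Gamma> * PA"
  \<comment> \<open>\<open>\<Lambda>\<close> may be nonsymmetric, so its adjoint image averages the
    congruences of \<open>\<Lambda>\<close> and its transpose; each is shown nonnegative at
    \<open>y\<close>.\<close>
  define ZB where "ZB = (1/2) \<cdot>\<^sub>m (PB\<^sup>T * \<Lambda> * PB + PB\<^sup>T * \<Lambda>\<^sup>T * PB)"
  have y: "y \<in> carrier_vec (n + 1)" using x by (simp add: y_def)
  have PA: "PA \<in> carrier_mat m (n + 1)" and PB: "PB \<in> carrier_mat (l + 1) (n + 1)"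
    using A_block_carrier[OF A] B_block_carrier[OF B] by (auto simp: PA_def PB_def)
  have \<Gamma>: "\<Gamma> \<in> sym_mats m" and \<Lambda>: "\<Lambda> \<in> carrier_mat (l + 1) (l + 1)"
    and \<Lambda>_nonneg: "\<And>i j. i < l + 1 \<Longrightarrow> j < l + 1 \<Longrightarrow> 0 \<le> \<Lambda> $$ (i, j)"
    and W: "W \<in> psd_mats (n + 1)" and S: "S \<in> psd_mats (n + 1)"
    and eq: "Q_bar n Q c
          - sym_adjoint (n + 1) (A_op m A b) \<Gamma>
          - sym_adjoint (n + 1) (B_op n l B d) \<Lambda>
          - sym_adjoint (n + 1) (D_op k) W
          - S - \<alpha> \<cdot>\<^sub>m E11 n = 0\<^sub>m (n + 1) (n + 1)"
    using dual by (auto simp: dual_feasible_def)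
  have Ws: "W \<in> sym_mats (n + 1)" using W by (simp add: psd_mats_def)
  have eq': "Q_bar n Q c - ZA - ZB - D_op k W - S - \<alpha> \<cdot>\<^sub>m E11 n = 0\<^sub>m (n + 1) (n + 1)"
    using eq unfolding sym_adjoint_A_op[OF A \<Gamma>] sym_adjoint_B_op[OF B \<Lambda>] sym_adjoint_D_op[OF Ws]
    by (simp add: ZA_def ZB_def PA_def PB_def)
  have Gc: "\<Gamma> \<in> carrier_mat m m" using \<Gamma> by (simp add: sym_mats_def)
  have carriers: "Q_bar n Q c \<in> carrier_mat (n + 1) (n + 1)" "ZA \<in> carrier_mat (n + 1) (n + 1)"
    "ZB \<in> carrier_mat (n + 1) (n + 1)" "D_op k W \<in> carrier_mat (n + 1) (n + 1)"
    "S \<in> carrier_mat (n + 1) (n + 1)" "E11 n \<in> carrier_mat (n + 1) (n + 1)"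
    using PA PB Q Gc S Ws D_op_eq[of W n k]
    by (auto simp: Q_bar_def ZA_def ZB_def E11_def sym_mats_def psd_mats_def
        simp del: One_nat_def)
  have "quad_form (Q_bar n Q c) y - quad_form ZA y - quad_form ZB y - quad_form (D_op k W) y
      - quad_form S y - \<alpha> * quad_form (E11 n) y
      = quad_form (Q_bar n Q c - ZA - ZB - D_op k W - S - \<alpha> \<cdot>\<^sub>m E11 n) y"
    using carriers y by (simp add: quad_form_minus[of _ "Suc n"] quad_form_smult[of _ "Suc n"]
        minus_carrier_mat)
  also have "\<dots> = 0"
    unfolding eq' using y by (simp add: quad_form_sum[of _ "Suc n"])
  finally have expand: "miqp_obj Q c x = quad_form ZA y + quad_form ZB y
      + quad_form (D_op k W) y + quad_form S y + \<alpha>"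
    using quad_form_Q_bar[OF Q c x(1)] quad_form_E11[OF x(1)] by (simp add: y_def)
  have "PA *\<^sub>v y = 0\<^sub>v m"
    using A_block_mult_vCons[OF A b x(1)] x(2) b by (simp add: PA_def y_def)
  then have ZA: "quad_form ZA y = 0"
    unfolding ZA_def quad_form_congruence[OF PA Gc y]
    using Gc by (simp add: quad_form_def)
  have By: "PB *\<^sub>v y = vCons 1 (B *\<^sub>v x - d)"
    using B_block_mult_vCons[OF B d x(1)] by (simp add: PB_def y_def)
  have By_nonneg: "0 \<le> (PB *\<^sub>v y) $ i" if "i < l + 1" for i
    using that x(3) B d unfolding By by (cases i) (auto simp: less_eq_vec_def)
  have Byc: "PB *\<^sub>v y \<in> carrier_vec (l + 1)" using PB y by simp
  have "0 \<le> quad_form \<Lambda> (PB *\<^sub>v y)" "0 \<le> quad_form \<Lambda>\<^sup>T (PB *\<^sub>v y)"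
    using \<Lambda> \<Lambda>_nonneg Byc By_nonneg by (auto intro!: quad_form_nonneg[of _ "Suc l"])
  moreover have "PB\<^sup>T * \<Lambda> * PB \<in> carrier_mat (n + 1) (n + 1)"
    "PB\<^sup>T * \<Lambda>\<^sup>T * PB \<in> carrier_mat (n + 1) (n + 1)" "\<Lambda>\<^sup>T \<in> carrier_mat (l + 1) (l + 1)"
    using PB \<Lambda> by auto
  ultimately have ZB: "0 \<le> quad_form ZB y"
    unfolding ZB_def using PB \<Lambda> y
    by (simp add: quad_form_smult[OF add_carrier_mat] quad_form_add quad_form_congruence
        del: assoc_mult_mat One_nat_def add_Suc_right add_0_right)
  show ?thesis
    using expand ZA ZB psd_quad_form_nonneg[OF S y] by (simp add: y_def)
qed

section \<open>Validity of the cut at optimal solutions\<close>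

theorem theorem5:
  fixes n m l k :: nat
    and Q A B :: "real mat" and c b d :: "real vec"
    and vUB vLB \<alpha> :: real and \<Gamma> \<Lambda> W S :: "real mat"
    and w :: "nat \<Rightarrow> real" and S0 N C :: "nat set"
  assumes Q: "Q \<in> sym_mats n" and c: "c \<in> carrier_vec n"
    and A: "A \<in> carrier_mat m n" and rank_A: "vec_space.rank m A = m"
    and b: "b \<in> carrier_vec m"
    and B: "B \<in> carrier_mat l n" and d: "d \<in> carrier_vec l"
    and k: "0 < k" "k < n"
    and feasible: "miqp_feasible n k A b B d \<noteq> {}"
    and bounded: "miqp_value n k Q c A b B d > -\<infinity>"
    and vUB: "miqp_value n k Q c A b B d \<le> ereal vUB"
    and dual: "(\<alpha>, \<Gamma>, \<Lambda>, W, S) \<in> dual_feasible n m l k Q c A b B d"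
    and vLB: "vLB = \<alpha>"
    and w: "w = dual_weight W"
    and scg: "scg_tuple n k w S0 N C"
    and gap: "(\<Sum>i = 1..k. nth_largest w {..<n} i) - (\<Sum>i\<in>S0. w i) - (\<Sum>i\<in>C. w i) > vUB - vLB"
  shows "\<forall>(x, z) \<in> miqp_optimal n k Q c A b B d.
    (\<Sum>i\<in>S0. z $ i) + (\<Sum>i\<in>N. 1 - z $ i) \<le> real (card S0) + real (card N) - 1"
proof (clarify, rule ccontr)
  fix x z assume opt: "(x, z) \<in> miqp_optimal n k Q c A b B d"
    and violated: "\<not> (\<Sum>i\<in>S0. z $ i) + (\<Sum>i\<in>N. 1 - z $ i) \<le> real (card S0) + real (card N) - 1"
  have x: "x \<in> carrier_vec n" "A *\<^sub>v x = b" "d \<le> B *\<^sub>v x"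
    and compl: "\<And>i. i < n \<Longrightarrow> x $ i * (1 - z $ i) = 0"
    and card: "(\<Sum>i<n. z $ i) \<le> real k"
    and bin: "\<And>i. i < n \<Longrightarrow> z $ i = 0 \<or> z $ i = 1"
    using opt by (auto simp: miqp_optimal_def miqp_feasible_def)
  have S0N: "S0 \<subseteq> {..<n}" "N \<subseteq> {..<n}"
    using scg by (auto simp: scg_tuple_def)
  then have fin: "finite S0" "finite N" by (auto intro: finite_subset)
  define T where "T = {i \<in> {..<n}. z $ i = 1}"
  \<comment> \<open>Optimality makes the objective at \<open>x\<close> a lower bound for all
    feasible values, hence at most their infimum.\<close>
  have "ereal (miqp_obj Q c x) \<le> miqp_value n k Q c A b B d"
    unfolding miqp_value_def using opt by (auto simp: miqp_optimal_def intro!: INF_greatest)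
  then have "miqp_obj Q c x \<le> vUB"
    using vUB by (metis ereal_less_eq(3) order_trans)
  have W: "W \<in> psd_mats (n + 1)"
    using dual by (auto simp: dual_feasible_def)
  \<comment> \<open>The negated cut, rewritten as a sum of nonnegative binary terms. Being below 1,
    it forces every term to vanish, so \<open>z\<close> is 1 on \<open>S0\<close> and 0 on
    \<open>N\<close>.\<close>
  have slack: "(\<Sum>i\<in>S0. 1 - z $ i) + (\<Sum>i\<in>N. z $ i) < 1"
    using violated by (simp add: sum_subtractf)
  have nonneg: "0 \<le> 1 - z $ i" "0 \<le> z $ i" if "i < n" for i
    using bin[OF that] by auto
  have sums_nonneg: "0 \<le> (\<Sum>i\<in>S0. 1 - z $ i)" "0 \<le> (\<Sum>i\<in>N. z $ i)"
    using S0N by (auto intro!: sum_nonneg nonneg)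
  have "z $ i = 1" if i: "i \<in> S0" for i
  proof -
    have "1 - z $ i \<le> (\<Sum>i\<in>S0. 1 - z $ i)"
      using S0N by (intro member_le_sum i fin nonneg) auto
    then have "z $ i \<noteq> 0"
      using slack sums_nonneg by auto
    then show ?thesis using i S0N bin[of i] by auto
  qed
  moreover have "z $ i \<noteq> 1" if i: "i \<in> N" for i
  proof -
    have "z $ i \<le> (\<Sum>i\<in>N. z $ i)"
      using S0N by (intro member_le_sum i fin nonneg) auto
    then show ?thesis
      using slack sums_nonneg by auto
  qed
  ultimately have T: "S0 \<subseteq> T" "T \<inter> N = {}" "T \<subseteq> {..<n}"
    using S0N by (auto simp: T_def)
  have sum_T: "(\<Sum>i<n. if z $ i = 1 then f i else 0) = sum f T" for f :: "nat \<Rightarrow> real"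
    unfolding T_def by (rule sum.inter_filter[symmetric]) simp
  have "real (card T) = (\<Sum>i<n. if z $ i = 1 then 1 else 0)"
    by (simp only: sum_T) simp
  also have "\<dots> = (\<Sum>i<n. z $ i)"
    using bin by (intro sum.cong) auto
  finally have "card T \<le> k"
    using card by simp
  then have scg_le: "sum w T \<le> sum w S0 + sum w C"
    using T by (intro scg_tuple_sum_le[OF scg]) (auto simp: w dual_weight_nonneg)
  have "- sum w T = (\<Sum>i<n. if z $ i = 1 then - w i else 0)"
    by (simp only: sum_T) (simp add: sum_negf)
  \<comment> \<open>Off the support, complementarity gives \<open>x $ i = 0\<close>, so both sides
    vanish; on it, the one-variable minimum applies.\<close>
  also have "\<dots> \<le> (\<Sum>i<n. 2 * (W $$ (0, Suc i) * x $ i) + W $$ (Suc i, Suc i) * (x $ i)\<^sup>2)"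
  proof (intro sum_mono)
    fix i assume "i \<in> {..<n}"
    then have i: "i < n" by simp
    show "(if z $ i = 1 then - w i else 0)
        \<le> 2 * (W $$ (0, Suc i) * x $ i) + W $$ (Suc i, Suc i) * (x $ i)\<^sup>2"
      using dual_weight_ge[OF W i, of "x $ i"] compl[OF i] by (auto simp: w)
  qed
  finally have "real k * W $$ (0, 0) - sum w T \<le> quad_form (D_op k W) (vCons 1 x)"
    using W x(1) by (subst quad_form_D_op[of W n]) (auto simp: psd_mats_def)
  \<comment> \<open>As \<open>k < n\<close>, all \<open>k\<close> ranks exist, and each ranked
    weight is at most the corner entry of \<open>W\<close>.\<close>
  moreover have "(\<Sum>i = 1..k. nth_largest w {..<n} i) \<le> real k * W $$ (0, 0)"
    using k by (intro sum_nth_largest_le) (auto simp: w dual_weight_le[OF W])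
  moreover have "\<alpha> + quad_form (D_op k W) (vCons 1 x) \<le> miqp_obj Q c x"
    by (rule dual_feasible_objective_ge[OF Q c A b B d dual x])
  ultimately show False
    using gap scg_le vLB \<open>miqp_obj Q c x \<le> vUB\<close> by linarith
qed

end
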